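(* Let $n \ge 1$, let $\mathbf{E} \in \mathbb{C}^{n\times n}$ be a perturbation matrix such that $\mathbf{A}_H + \mathbf{E} = \tilde{\mathbf{V}}_H \tilde{\boldsymbol{\Lambda}}_H \tilde{\mathbf{V}}_H^{-1}$ with $\tilde{\boldsymbol{\Lambda}}_H$ diagonal, and let $G_{\mathrm{Pert}}$ and $G_{\mathrm{DPLR}}$ be the transfer functions of the perturbed and DPLR systems defined in the context. Assume $\mathbf{C}_{\mathrm{Pert}}\tilde{\mathbf{V}}_H^{-1} = \mathbf{C}_{\mathrm{DPLR}}\mathbf{V}_H^{-1}$ and $\mathbf{D}_{\mathrm{Pert}} = \mathbf{D}_{\mathrm{DPLR}}$. Suppose $\|\mathbf{E}\|_2 \le \epsilon$ and that the matrices are normalized so that $$\|\tilde{\mathbf{V}}_H\mathbf{B}_{\mathrm{Pert}}\| = \|\mathbf{V}_H\mathbf{B}_{\mathrm{DPLR}}\| = \|\mathbf{C}_{\mathrm{Pert}}\tilde{\mathbf{V}}_H^{-1}\| = \|\mathbf{C}_{\mathrm{DPLR}}\mathbf{V}_H^{-1}\| = 1.$$ Then for every $s$ on the imaginary axis, $$ |G_{\mathrm{Pert}}(s) - G_{\mathrm{DPLR}}(s)| \le (2\ln(n)+4)\,\epsilon + \mathcal{O}\bigl(\sqrt{\log(n)}\,\epsilon^2\bigr) $$ as $\epsilon \to 0$, where the implied constant is absolute (uniform in $s$, $\mathbf{E}$ and $n$).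
   Context: Define the real $n \times n$ matrix $\mathbf{A}_H$ and the column vector $\mathbf{B}_H \in \mathbb{R}^n$ (HiPPO-LegS) by $(A_H)_{jk} = -\sqrt{2j-1}\sqrt{2k-1}$ if $j>k$, $(A_H)_{jj} = -j$, $(A_H)_{jk}=0$ if $j<k$; and $(B_H)_j = \sqrt{(2j-1)/2}$. The matrix $\mathbf{A}_H^\perp = \mathbf{A}_H + \mathbf{B}_H\mathbf{B}_H^\top$ is normal; write $\mathbf{A}_H^\perp = \mathbf{V}_H \boldsymbol{\Lambda}_H \mathbf{V}_H^{-1}$ with $\mathbf{V}_H$ unitary and $\boldsymbol{\Lambda}_H$ diagonal. The DPLR system has $\mathbf{A}_{\mathrm{DPLR}} = \mathbf{V}_H^{-1}\mathbf{A}_H\mathbf{V}_H = \boldsymbol{\Lambda}_H - \mathbf{V}_H^{-1}\mathbf{B}_H\mathbf{B}_H^\top\mathbf{V}_H$ and the perturbed system has $\mathbf{A}_{\mathrm{Pert}} = \tilde{\boldsymbol{\Lambda}}_H = \tilde{\mathbf{V}}_H^{-1}(\mathbf{A}_H+\mathbf{E})\tilde{\mathbf{V}}_H$. The input matrices are $\mathbf{B}_{\mathrm{DPLR}} = \mathbf{V}_H^{-1}\mathbf{b}$ and $\mathbf{B}_{\mathrm{Pert}} = \tilde{\mathbf{V}}_H^{-1}\mathbf{b}$, where (because of the normalization) $\mathbf{b} = \mathbf{B}_H/\|\mathbf{B}_H\|$; $\mathbf{A}_H$ itself is not rescaled. The output matrices $\mathbf{C}_{\mathrm{DPLR}}, \mathbf{C}_{\mathrm{Pert}}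 \in \mathbb{C}^{1\times n}$ and feedthrough scalars $\mathbf{D}_{\mathrm{DPLR}}, \mathbf{D}_{\mathrm{Pert}} \in \mathbb{C}$ are arbitrary subject to the stated assumptions. For $\bullet \in \{\mathrm{DPLR}, \mathrm{Pert}\}$ the transfer function is $G_\bullet(s) = \mathbf{C}_\bullet (s\mathbf{I} - \mathbf{A}_\bullet)^{-1}\mathbf{B}_\bullet + \mathbf{D}_\bullet$. $\|\cdot\|$ and $\|\cdot\|_2$ denote the vector or matrix $2$-norm. *)

theory Defs
  imports "HOL-Analysis.L2_Norm" "Jordan_Normal_Form.Schur_Decomposition"
    "Jordan_Normal_Form.Gauss_Jordan_Elimination"
begin

definition l2_norm :: "'a :: real_normed_vector vec \<Rightarrow> real" where
  "l2_norm v = L2_set (\<lambda>i. norm (v $ i)) {..<dim_vec v}"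

definition spectral_norm :: "complex mat \<Rightarrow> real" where
  "spectral_norm M =
     (SUP v \<in> {v \<in> carrier_vec (dim_col M). l2_norm v \<le> 1}. l2_norm (M *\<^sub>v v))"

(* Unspecified if M is singular. *)
definition minv :: "complex mat \<Rightarrow> complex mat" where
  "minv M = the (mat_inverse M)"

definition unitary_mat :: "complex mat \<Rightarrow> bool" where
  "unitary_mat U \<longleftrightarrow>
     square_mat U \<and> inverts_mat U (mat_adjoint U) \<and> inverts_mat (mat_adjoint U) U"

(* M = V * L * V^{-1}, where V is invertible and L is diagonal. *)
definition diagonalized_by :: "complex mat \<Rightarrow> complex mat \<Rightarrow> complex mat \<Rightarrow> bool" where
  "diagonalized_by M V L \<longleftrightarrow> similar_mat_wit M L V (minv V) \<and> diagonal_mat L"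

(* Indices start at 0 here, so the usual 2j - 1 with j = 1, ..., n becomes 2i + 1
   with i = j - 1, and the diagonal entry -j becomes -(i + 1). *)
definition hippo_A_real :: "nat \<Rightarrow> real mat" where
  "hippo_A_real n = mat n n (\<lambda>(i, k).
     if i > k then - sqrt (2 * real i + 1) * sqrt (2 * real k + 1)
     else if i = k then - (real i + 1)
     else 0)"

definition hippo_B_real :: "nat \<Rightarrow> real vec" where
  "hippo_B_real n = vec n (\<lambda>i. sqrt ((2 * real i + 1) / 2))"

definition hippo_A :: "nat \<Rightarrow> complex mat" where
  "hippo_A n = map_mat complex_of_real (hippo_A_real n)"

definition hippo_B :: "nat \<Rightarrow> complex vec" where
  "hippo_B n = map_vec complex_of_real (hippo_B_real n)"

(* A + B * B^T, with B read as a single column and B^T as a single row. *)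
definition hippo_A_perp :: "nat \<Rightarrow> complex mat" where
  "hippo_A_perp n = hippo_A n + mat_of_cols n [hippo_B n] * mat_of_rows n [hippo_B n]"

definition hippo_b :: "nat \<Rightarrow> complex vec" where
  "hippo_b n = complex_of_real (1 / l2_norm (hippo_B n)) \<cdot>\<^sub>v hippo_B n"

definition A_DPLR :: "nat \<Rightarrow> complex mat \<Rightarrow> complex mat" where
  "A_DPLR n V = minv V * hippo_A n * V"

definition B_DPLR :: "nat \<Rightarrow> complex mat \<Rightarrow> complex vec" where
  "B_DPLR n V = minv V *\<^sub>v hippo_b n"

definition A_Pert :: "nat \<Rightarrow> complex mat \<Rightarrow> complex mat \<Rightarrow> complex mat" where
  "A_Pert n E W = minv W * (hippo_A n + E) * W"

definition B_Pert :: "nat \<Rightarrow> complex mat \<Rightarrow> complex vec" where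
  "B_Pert n W = minv W *\<^sub>v hippo_b n"

(* C is a matrix with a single row, so the product is a vector of length 1. *)
definition transfer_fun ::
    "complex mat \<Rightarrow> complex vec \<Rightarrow> complex mat \<Rightarrow> complex \<Rightarrow> complex \<Rightarrow> complex" where
  "transfer_fun A B C D s =
     (C *\<^sub>v (minv (s \<cdot>\<^sub>m 1\<^sub>m (dim_row A) - A) *\<^sub>v B)) $ 0 + D"

end

theory Submission
  imports Defs
begin

text \<open>Since \<open>A_H + A_H\<^sup>T = - I - 2 B_H B_H\<^sup>T\<close>, on the imaginary axis
  \<open>Re \<langle>(s - A_H) y, y\<rangle> = \<bar>y\<bar>\<^sup>2/2 + \<bar>B_H\<^sup>T y\<bar>\<^sup>2\<close>. This coercivity bounds the perturbed resolvent
  by \<open>1/(1/2 - \<parallel>E\<parallel>)\<close> and the unperturbed state \<open>(s - A_H)\<^sup>-\<^sup>1 b\<close> by \<open>1\<close>, uniformly in \<open>n\<close>. Both transfer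
  functions are invariant under the changes of basis, so the resolvent identity
  \<open>(s - A_H - E)\<^sup>-\<^sup>1 - (s - A_H)\<^sup>-\<^sup>1 = (s - A_H - E)\<^sup>-\<^sup>1 E (s - A_H)\<^sup>-\<^sup>1\<close> bounds their difference by
  \<open>4 \<epsilon>\<close> as soon as \<open>\<epsilon> \<le> 1/4\<close>; the logarithmic and quadratic terms are not needed.\<close>

section \<open>Euclidean norm and Hermitian inner product\<close>

lemma l2_norm_nonneg [simp]: "l2_norm v \<ge> 0"
  by (simp add: l2_norm_def)

lemma norm_index_le_l2_norm:
  assumes "i < dim_vec v"
  shows "norm (v $ i) \<le> l2_norm v"
  unfolding l2_norm_def
  by (rule member_le_L2_set[where f = "\<lambda>i. norm (v $ i)"]) (use assms in auto)

lemma l2_norm_eq_0_imp: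
  assumes "v \<in> carrier_vec n" "l2_norm v = 0"
  shows "v = 0\<^sub>v n"
  using norm_index_le_l2_norm[of _ v] assms by (intro eq_vecI) auto

lemma l2_norm_zero [simp]: "l2_norm (0\<^sub>v n) = 0"
  by (simp add: l2_norm_def L2_set_def)

lemma l2_norm_smult:
  fixes c :: complex
  shows "l2_norm (c \<cdot>\<^sub>v v) = cmod c * l2_norm v"
  unfolding l2_norm_def by (auto simp: L2_set_right_distrib norm_mult intro!: L2_set_cong)

lemma Re_cscalar_prod_self:
  "Re (v \<bullet>c v) = (l2_norm v)\<^sup>2"
proof -
  have "(l2_norm v)\<^sup>2 = (\<Sum>i = 0..<dim_vec v. (cmod (v $ i))\<^sup>2)"
    by (simp add: l2_norm_def L2_set_def sum_nonneg lessThan_atLeast0)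
  then show ?thesis
    by (simp only: cmod_power2) (simp add: scalar_prod_def power2_eq_square)
qed

text \<open>Cauchy-Schwarz, obtained from its real form by passing to the moduli of the
  entries.\<close>

lemma Re_cscalar_prod_le:
  assumes "u \<in> carrier_vec n" "v \<in> carrier_vec n"
  shows "Re (u \<bullet>c v) \<le> l2_norm u * l2_norm v"
proof -
  have "Re (u \<bullet>c v) \<le> cmod (u \<bullet>c v)"
    by (rule complex_Re_le_cmod)
  also have "\<dots> \<le> (\<Sum>i<n. \<bar>cmod (u $ i)\<bar> * \<bar>cmod (v $ i)\<bar>)"
    using assms by (auto simp: scalar_prod_def lessThan_atLeast0 norm_mult intro!: sum_norm_le)
  also have "\<dots> \<le> l2_norm u * l2_norm v"
    using L2_set_mult_ineq[of "\<lambda>i. cmod (u $ i)" "\<lambda>i. cmod (v $ i)" "{..<n}"] assms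
    by (simp add: l2_norm_def)
  finally show ?thesis .
qed

section \<open>The operator norm as a supremum\<close>

text \<open>A supremum over reals dominates its members only once the set is known to be bounded.
  The crude bound by the sum of all entry moduli suffices, because coordinates of a vector in the
  unit ball have modulus at most 1.\<close>

lemma bdd_above_spectral_norm:
  fixes M :: "complex mat"
  shows "bdd_above ((\<lambda>v. l2_norm (M *\<^sub>v v)) ` {v \<in> carrier_vec (dim_col M). l2_norm v \<le> 1})"
proof (rule bdd_aboveI2)
  fix v :: "complex vec" assume v: "v \<in> {v \<in> carrier_vec (dim_col M). l2_norm v \<le> 1}"
  have "l2_norm (M *\<^sub>v v) \<le> (\<Sum>i<dim_row M. cmod ((M *\<^sub>v v) $ i))"
    unfolding l2_norm_def by (simp add: L2_set_le_sum del: index_mult_mat_vec)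
  also have "\<dots> \<le> (\<Sum>i<dim_row M. \<Sum>j = 0..<dim_col M. cmod (M $$ (i, j)))"
  proof (rule sum_mono)
    fix i assume i: "i \<in> {..<dim_row M}"
    have "cmod ((M *\<^sub>v v) $ i) = cmod (\<Sum>j = 0..<dim_col M. M $$ (i, j) * v $ j)"
      using i v by (auto simp: scalar_prod_def)
    also have "\<dots> \<le> (\<Sum>j = 0..<dim_col M. cmod (M $$ (i, j)))"
    proof (rule sum_norm_le)
      fix j assume j: "j \<in> {0..<dim_col M}"
      have "cmod (v $ j) \<le> 1"
        using norm_index_le_l2_norm[of j v] v j by auto
      then show "cmod (M $$ (i, j) * v $ j) \<le> cmod (M $$ (i, j))"
        by (simp add: norm_mult mult_left_le)
    qed
    finally show "cmod ((M *\<^sub>v v) $ i) \<le> (\<Sum>j = 0..<dim_col M. cmod (M $$ (i, j)))" .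
  qed
  finally show "l2_norm (M *\<^sub>v v) \<le> (\<Sum>i<dim_row M. \<Sum>j = 0..<dim_col M. cmod (M $$ (i, j)))" .
qed

text \<open>By homogeneity it is enough to test the normalized vector \<open>w\<close>; the zero
  vector, which cannot be normalized, is treated apart.\<close>

lemma l2_norm_mult_le:
  fixes M :: "complex mat"
  assumes M: "M \<in> carrier_mat m n" and v: "v \<in> carrier_vec n"
  shows "l2_norm (M *\<^sub>v v) \<le> spectral_norm M * l2_norm v"
proof (cases "l2_norm v = 0")
  case True
  then have "M *\<^sub>v v = 0\<^sub>v m"
    using l2_norm_eq_0_imp[OF v] M by auto
  with True show ?thesis by simp
next
  case False
  define r where "r = l2_norm v"
  have r: "r > 0" using False by (simp add: r_def less_le)
  define w where "w = complex_of_real (1 / r) \<cdot>\<^sub>v v"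
  have w: "w \<in> carrier_vec n" using v by (simp add: w_def)
  have "l2_norm w = 1"
    using r unfolding w_def l2_norm_smult by (simp add: r_def[symmetric] norm_divide)
  then have "l2_norm (M *\<^sub>v w) \<le> spectral_norm M"
    unfolding spectral_norm_def using M w by (intro cSUP_upper bdd_above_spectral_norm) auto
  moreover have "M *\<^sub>v w = complex_of_real (1 / r) \<cdot>\<^sub>v (M *\<^sub>v v)"
    unfolding w_def by (rule mult_mat_vec[OF M v])
  ultimately show ?thesis
    using r by (simp add: l2_norm_smult norm_divide field_simps flip: r_def)
qed

lemma spectral_norm_nonneg: "spectral_norm M \<ge> 0"
proof -
  have "l2_norm (M *\<^sub>v 0\<^sub>v (dim_col M)) \<le> spectral_norm M"
    unfolding spectral_norm_def by (intro cSUP_upper bdd_above_spectral_norm) auto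
  then show ?thesis using l2_norm_nonneg order_trans by blast
qed

section \<open>Inverses and change of basis\<close>

lemma minv_inverse:
  assumes A: "A \<in> carrier_mat n n" and det: "det A \<noteq> 0"
  shows "A * minv A = 1\<^sub>m n" "minv A * A = 1\<^sub>m n" "minv A \<in> carrier_mat n n"
proof -
  obtain B where "mat_inverse A = Some B"
    \<comment> \<open>Nonzero determinant makes \<open>A\<close> a unit of the matrix ring, which
      excludes \<open>None\<close>. The argument \<open>()\<close> fills the irrelevant extension
      slot of the ring record.\<close>
    using mat_inverse(1)[OF A, of "()"] det_non_zero_imp_unit[OF A det, of "()"]
    by (cases "mat_inverse A") auto
  then show "A * minv A = 1\<^sub>m n" "minv A * A = 1\<^sub>m n" "minv A \<in> carrier_mat n n"
    using mat_inverse(2)[OF A] by (auto simp: minv_def)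
qed

text \<open>A one-sided inverse is enough: \<open>det A * det X = 1\<close> forces \<open>A\<close>
  to be invertible, and \<open>minv A\<close> can then be cancelled.\<close>

lemma minv_eqI:
  assumes A: "A \<in> carrier_mat n n" and X: "X \<in> carrier_mat n n" and AX: "A * X = 1\<^sub>m n"
  shows "minv A = X"
proof -
  have det: "det A \<noteq> 0"
    using arg_cong[OF AX, of det] det_mult[OF A X] by auto
  note inv = minv_inverse[OF A det]
  have "minv A = minv A * (A * X)" using AX inv by simp
  also have "\<dots> = minv A * A * X" by (rule assoc_mult_mat[OF inv(3) A X, symmetric])
  finally show ?thesis using inv X by simp
qed

text \<open>Conjugation by \<open>W\<close> commutes with the shift by \<open>s\<close>, so the new
  resolvent is \<open>W' * R * W\<close>. Its right factor cancels the \<open>W'\<close> in the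
  input, and its left factor is absorbed into the output row.\<close>

lemma transfer_fun_similar:
  assumes M: "M \<in> carrier_mat n n" and W: "W \<in> carrier_mat n n" and W': "W' \<in> carrier_mat n n"
    and WW': "W * W' = 1\<^sub>m n" and W'W: "W' * W = 1\<^sub>m n"
    and b: "b \<in> carrier_vec n" and C: "C \<in> carrier_mat m n"
    and det: "det (s \<cdot>\<^sub>m 1\<^sub>m n - M) \<noteq> 0"
  shows "transfer_fun (W' * M * W) (W' *\<^sub>v b) C D s = transfer_fun M b (C * W') D s"
proof -
  let ?N = "s \<cdot>\<^sub>m 1\<^sub>m n - M"
  have N: "?N \<in> carrier_mat n n" using M by (intro minus_carrier_mat) auto
  define R where "R = minv ?N"
  note R = minv_inverse[OF N det, folded R_def]
  have eq: "s \<cdot>\<^sub>m 1\<^sub>m n - W' * M * W = W' * ?N * W"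
  proof -
    have "W' * ?N * W = (W' * (s \<cdot>\<^sub>m 1\<^sub>m n) - W' * M) * W"
      using M W' by (subst mult_minus_distrib_mat) auto
    also have "\<dots> = W' * (s \<cdot>\<^sub>m 1\<^sub>m n) * W - W' * M * W"
      using M W W' by (subst minus_mult_distrib_mat) auto
    also have "W' * (s \<cdot>\<^sub>m 1\<^sub>m n) * W = s \<cdot>\<^sub>m 1\<^sub>m n"
      using W W' W'W by (simp add: mult_smult_distrib[of _ n n _ n] mult_smult_assoc_mat[of _ n n _ n])
    finally show ?thesis by simp
  qed
  \<comment> \<open>Reassociating brings \<open>W * W'\<close> together in the middle, after which
    \<open>?N * R\<close> collapses as well.\<close>
  have "W' * ?N * W * (W' * R * W) = W' * ?N * (W * W') * (R * W)"
    using N R(3) W W' by (simp add: assoc_mult_mat[of _ n n _ n _ n])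
  also have "\<dots> = W' * (?N * R) * W"
    using N R(3) W W' WW' by (simp add: assoc_mult_mat[of _ n n _ n _ n])
  finally have inv: "minv (W' * ?N * W) = W' * R * W"
    using N R W W' W'W by (intro minv_eqI[of _ n]) auto
  have "W *\<^sub>v (W' *\<^sub>v b) = b"
    using assoc_mult_mat_vec[OF W W' b] WW' b by simp
  then have "(W' * R * W) *\<^sub>v (W' *\<^sub>v b) = W' *\<^sub>v (R *\<^sub>v b)"
    using W W' R(3) b by (simp add: assoc_mult_mat_vec[of _ n n _ n] del: assoc_mult_mat)
  then have "C *\<^sub>v ((W' * R * W) *\<^sub>v (W' *\<^sub>v b)) = (C * W') *\<^sub>v (R *\<^sub>v b)"
    using C W' R(3) b by simp
  then show ?thesis
    using M W' by (simp add: transfer_fun_def eq inv R_def)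
qed

section \<open>The HiPPO matrix and its dissipation identity\<close>

lemma hippo_carrier [simp]:
  "hippo_A n \<in> carrier_mat n n" "hippo_B n \<in> carrier_vec n" "hippo_b n \<in> carrier_vec n"
  by (auto simp: hippo_A_def hippo_A_real_def hippo_B_def hippo_B_real_def hippo_b_def)

lemma hippo_dims [simp]:
  "dim_row (hippo_A n) = n" "dim_col (hippo_A n) = n" "dim_vec (hippo_B n) = n"
  "dim_vec (hippo_b n) = n"
  by (auto simp: hippo_A_def hippo_A_real_def hippo_B_def hippo_B_real_def hippo_b_def)

lemma hippo_A_perp_carrier [simp]: "hippo_A_perp n \<in> carrier_mat n n"
  using hippo_carrier[of n] by (auto simp: hippo_A_perp_def hippo_B_def hippo_B_real_def)

text \<open>Off the diagonal exactly one of the two entries is nonzero, and it equals minus twice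
  the product of the \<open>B\<close> entries. On the diagonal the identity reads
  \<open>-2 (i + 1) = -1 - (2 i + 1)\<close>.\<close>

lemma hippo_A_symmetric_part:
  assumes "i < n" "k < n"
  shows "hippo_A_real n $$ (i, k) + hippo_A_real n $$ (k, i) =
    - of_bool (i = k) - 2 * (hippo_B_real n $ i * hippo_B_real n $ k)"
proof -
  have "2 * (hippo_B_real n $ i * hippo_B_real n $ k) = sqrt (2 * real i + 1) * sqrt (2 * real k + 1)"
    using assms by (simp add: hippo_B_real_def real_sqrt_divide)
  then show ?thesis
    using assms by (auto simp: hippo_A_real_def)
qed

text \<open>As the matrix is real, the real part of its Hermitian form depends only on the symmetric
  part, which is minus half the identity minus a rank-one term.\<close>

lemma Re_hippo_A_form:
  assumes y: "y \<in> carrier_vec n"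
  shows "Re ((hippo_A n *\<^sub>v y) \<bullet>c y) = - ((l2_norm y)\<^sup>2 / 2 + (cmod (hippo_B n \<bullet> y))\<^sup>2)"
proof -
  define a where "a i k = hippo_A_real n $$ (i, k)" for i k
  define \<beta> where "\<beta> i = hippo_B_real n $ i" for i
  \<comment> \<open>Swapping the indices conjugates the product, so \<open>r\<close> is
    symmetric.\<close>
  define r where "r i k = Re (y $ k * cnj (y $ i))" for i k
  have dims: "dim_vec y = n" using y by auto
  have r_sym: "r k i = r i k" for i k by (simp add: r_def)
  have A: "(hippo_A n *\<^sub>v y) $ i = (\<Sum>k<n. of_real (a i k) * y $ k)" if "i < n" for i
    using that dims
    by (auto simp: scalar_prod_def hippo_A_def hippo_A_real_def a_def lessThan_atLeast0
        intro!: sum.cong)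
  have "(hippo_A n *\<^sub>v y) \<bullet>c y = (\<Sum>i<n. (hippo_A n *\<^sub>v y) $ i * cnj (y $ i))"
    using dims by (simp add: scalar_prod_def lessThan_atLeast0)
  also have "\<dots> = (\<Sum>i<n. \<Sum>k<n. of_real (a i k) * (y $ k * cnj (y $ i)))"
    by (intro sum.cong refl) (simp add: A sum_distrib_right mult.assoc del: index_mult_mat_vec)
  finally have S: "Re ((hippo_A n *\<^sub>v y) \<bullet>c y) = (\<Sum>i<n. \<Sum>k<n. a i k * r i k)"
    by (simp add: r_def algebra_simps)
  have B: "hippo_B n \<bullet> y = (\<Sum>k<n. of_real (\<beta> k) * y $ k)"
    using dims by (auto simp: scalar_prod_def hippo_B_def hippo_B_real_def \<beta>_def
        lessThan_atLeast0 intro!: sum.cong)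
  have "complex_of_real ((cmod (hippo_B n \<bullet> y))\<^sup>2) =
      (\<Sum>k<n. of_real (\<beta> k) * y $ k) * cnj (\<Sum>i<n. of_real (\<beta> i) * y $ i)"
    unfolding B by (rule complex_norm_square)
  also have "\<dots> = (\<Sum>i<n. \<Sum>k<n. of_real (\<beta> i * \<beta> k) * (y $ k * cnj (y $ i)))"
    unfolding cnj_sum sum_product by (subst sum.swap) (simp add: algebra_simps)
  finally have "Re (complex_of_real ((cmod (hippo_B n \<bullet> y))\<^sup>2)) =
      Re (\<Sum>i<n. \<Sum>k<n. of_real (\<beta> i * \<beta> k) * (y $ k * cnj (y $ i)))"
    by (rule arg_cong)
  then have B2: "(cmod (hippo_B n \<bullet> y))\<^sup>2 = (\<Sum>i<n. \<Sum>k<n. \<beta> i * \<beta> k * r i k)"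
    unfolding Re_complex_of_real Re_sum r_def
    by (simp only: times_complex.sel Re_complex_of_real Im_complex_of_real) simp
  have N: "(l2_norm y)\<^sup>2 = (\<Sum>i<n. \<Sum>k<n. of_bool (i = k) * r i k)"
  proof -
    have "(l2_norm y)\<^sup>2 = (\<Sum>i<n. r i i)"
      unfolding Re_cscalar_prod_self[symmetric] r_def
      using dims by (simp add: scalar_prod_def lessThan_atLeast0)
    then show ?thesis
      by (simp add: of_bool_def if_distrib[of "\<lambda>x. x * _"] cong: if_cong)
  qed
  \<comment> \<open>The indices are exchanged in one of two copies of the sum; symmetry of
    \<open>r\<close> then leaves the coefficient \<open>a i k + a k i\<close>.\<close>
  have "2 * (\<Sum>i<n. \<Sum>k<n. a i k * r i k) =
      (\<Sum>i<n. \<Sum>k<n. a i k * r i k) + (\<Sum>i<n. \<Sum>k<n. a k i * r k i)"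
    by (subst (3) sum.swap) simp
  also have "\<dots> = (\<Sum>i<n. \<Sum>k<n. (a i k + a k i) * r i k)"
    by (simp add: sum.distrib algebra_simps r_sym)
  also have "\<dots> = (\<Sum>i<n. \<Sum>k<n. - (of_bool (i = k) * r i k) - 2 * (\<beta> i * \<beta> k * r i k))"
    by (intro sum.cong refl) (simp add: a_def \<beta>_def hippo_A_symmetric_part algebra_simps)
  also have "\<dots> = - (l2_norm y)\<^sup>2 - 2 * (cmod (hippo_B n \<bullet> y))\<^sup>2"
    unfolding N B2 by (simp add: sum_subtractf sum_negf sum_distrib_left)
  finally show ?thesis unfolding S by simp
qed

text \<open>For imaginary \<open>s\<close> the shift contributes \<open>s\<close> times a real
  number, hence nothing to the real part. This is the source of uniformity in
  \<open>s\<close>.\<close>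

lemma Re_hippo_resolvent_form:
  assumes y: "y \<in> carrier_vec n" and s: "Re s = 0"
  shows "Re (((s \<cdot>\<^sub>m 1\<^sub>m n - hippo_A n) *\<^sub>v y) \<bullet>c y) =
    (l2_norm y)\<^sup>2 / 2 + (cmod (hippo_B n \<bullet> y))\<^sup>2"
proof -
  have eq: "(s \<cdot>\<^sub>m 1\<^sub>m n - hippo_A n) *\<^sub>v y = s \<cdot>\<^sub>v y - hippo_A n *\<^sub>v y"
  proof -
    have "(s \<cdot>\<^sub>m 1\<^sub>m n) *\<^sub>v y = s \<cdot>\<^sub>v y"
      using y by (intro eq_vecI) auto
    then show ?thesis
      using y by (subst minus_mult_distrib_mat_vec[of _ n n]) auto
  qed
  have "((s \<cdot>\<^sub>m 1\<^sub>m n - hippo_A n) *\<^sub>v y) \<bullet>c y = s * (y \<bullet>c y) - (hippo_A n *\<^sub>v y) \<bullet>c y"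
    unfolding eq using y mult_mat_vec_carrier[OF hippo_carrier(1) y]
    by (subst minus_scalar_prod_distrib[of _ n]) auto
  moreover have "Im (y \<bullet>c y) = 0"
    by (simp add: scalar_prod_def)
  ultimately show ?thesis
    using s Re_hippo_A_form[OF y] by simp
qed

section \<open>Invertibility and lower bounds under perturbation\<close>

text \<open>Pairing with \<open>y\<close> yields at least half of its squared norm, from which
  \<open>E\<close> removes at most \<open>spectral_norm E\<close> times that square. Cauchy-Schwarz
  bounds the pairing from above, and one factor of the norm of \<open>y\<close> cancels.\<close>

lemma perturbed_resolvent_lower_bound:
  assumes E: "E \<in> carrier_mat n n" and y: "y \<in> carrier_vec n" and s: "Re s = 0"
  shows "(1 / 2 - spectral_norm E) * l2_norm y \<le> l2_norm ((s \<cdot>\<^sub>m 1\<^sub>m n - (hippo_A n + E)) *\<^sub>v y)"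
proof (cases "l2_norm y = 0")
  case False
  let ?N = "s \<cdot>\<^sub>m 1\<^sub>m n - hippo_A n"
  let ?z = "(s \<cdot>\<^sub>m 1\<^sub>m n - (hippo_A n + E)) *\<^sub>v y"
  have N: "?N \<in> carrier_mat n n" by (intro minus_carrier_mat) auto
  have "s \<cdot>\<^sub>m 1\<^sub>m n - (hippo_A n + E) = ?N - E"
    using E hippo_carrier(1)[of n] by (intro eq_matI) auto
  then have z: "?z = ?N *\<^sub>v y - E *\<^sub>v y"
    using N E y by (simp add: minus_mult_distrib_mat_vec)
  have carr: "?z \<in> carrier_vec n" using z N E y by auto
  have "?z \<bullet>c y = (?N *\<^sub>v y) \<bullet>c y - (E *\<^sub>v y) \<bullet>c y"
    unfolding z using N E y by (subst minus_scalar_prod_distrib[of _ n]) auto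
  then have "Re (?z \<bullet>c y) \<ge> (l2_norm y)\<^sup>2 / 2 - Re ((E *\<^sub>v y) \<bullet>c y)"
    using Re_hippo_resolvent_form[OF y s] by simp
  moreover have "Re ((E *\<^sub>v y) \<bullet>c y) \<le> l2_norm (E *\<^sub>v y) * l2_norm y"
    using E y by (intro Re_cscalar_prod_le) auto
  moreover have "l2_norm (E *\<^sub>v y) * l2_norm y \<le> spectral_norm E * l2_norm y * l2_norm y"
    by (intro mult_right_mono l2_norm_mult_le[OF E y]) simp
  moreover have "Re (?z \<bullet>c y) \<le> l2_norm ?z * l2_norm y"
    by (rule Re_cscalar_prod_le[OF carr y])
  ultimately have "((1 / 2 - spectral_norm E) * l2_norm y) * l2_norm y \<le> l2_norm ?z * l2_norm y"
    by (simp add: power2_eq_square algebra_simps)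
  then show ?thesis using False by (simp add: less_le)
qed simp

text \<open>With a positive coercivity constant the lower bound forces every kernel vector to
  vanish.\<close>

lemma perturbed_resolvent_det_nonzero:
  assumes E: "E \<in> carrier_mat n n" and s: "Re s = 0" and small: "spectral_norm E < 1 / 2"
  shows "det (s \<cdot>\<^sub>m 1\<^sub>m n - (hippo_A n + E)) \<noteq> 0"
proof
  assume "det (s \<cdot>\<^sub>m 1\<^sub>m n - (hippo_A n + E)) = 0"
  then obtain v where v: "v \<in> carrier_vec n" "v \<noteq> 0\<^sub>v n"
    and "(s \<cdot>\<^sub>m 1\<^sub>m n - (hippo_A n + E)) *\<^sub>v v = 0\<^sub>v n"
    using E by (subst (asm) det_0_iff_vec_prod_zero[of _ n]) auto
  then have "(1 / 2 - spectral_norm E) * l2_norm v \<le> 0"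
    using perturbed_resolvent_lower_bound[OF E v(1) s] by simp
  then have "l2_norm v = 0"
    using small l2_norm_nonneg[of v] by (simp add: mult_le_0_iff)
  then show False using l2_norm_eq_0_imp v by auto
qed

text \<open>This makes the unperturbed resolvent the case \<open>E = 0\<close> of the perturbed
  one.\<close>

lemma spectral_norm_zero: "spectral_norm (0\<^sub>m n n) = 0"
proof -
  have "(\<lambda>v. l2_norm ((0\<^sub>m n n :: complex mat) *\<^sub>v v)) ` {v \<in> carrier_vec n. l2_norm v \<le> 1} = {0 :: real}"
    (is "?f ` ?S = _")
  proof -
    have "?f v = 0" if "v \<in> ?S" for v
    proof -
      have "(0\<^sub>m n n :: complex mat) *\<^sub>v v = 0\<^sub>v n"
        using that by (intro eq_vecI) auto
      then show ?thesis by simp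
    qed
    \<comment> \<open>The unit ball must be nonempty for the image to be a singleton.\<close>
    moreover have "0\<^sub>v n \<in> ?S" by simp
    ultimately show ?thesis by (metis (no_types, lifting) image_constant image_cong)
  qed
  then show ?thesis by (simp add: spectral_norm_def)
qed

lemma hippo_resolvent_det_nonzero:
  assumes "Re s = 0"
  shows "det (s \<cdot>\<^sub>m 1\<^sub>m n - hippo_A n) \<noteq> 0"
  using perturbed_resolvent_det_nonzero[of "0\<^sub>m n n" n s] assms by (simp add: spectral_norm_zero)

section \<open>The unperturbed state driven by the normalized input\<close>

text \<open>The first entry alone gives this bound independent of \<open>n\<close>; it keeps the
  squared normalizing factor of \<open>hippo_b\<close> at most 2.\<close>

lemma l2_norm_hippo_B_ge:
  assumes "n \<ge> 1"
  shows "l2_norm (hippo_B n) \<ge> sqrt (1 / 2)"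
  using norm_index_le_l2_norm[of 0 "hippo_B n"] assms by (simp add: hippo_B_def hippo_B_real_def)

text \<open>Testing \<open>(s - A_H) y = b\<close> against \<open>y\<close> gives \<open>\<bar>y\<bar>\<^sup>2/2 + t\<^sup>2 \<le> t / \<bar>B_H\<bar> \<le> t\<^sup>2 + 1/2\<close>
  with \<open>t = \<bar>B_H\<^sup>T y\<bar>\<close>: the rank-one part of the dissipation absorbs the input direction.\<close>

lemma hippo_resolvent_input_bound:
  assumes y: "y \<in> carrier_vec n" and s: "Re s = 0" and n: "n \<ge> 1"
    and eq: "(s \<cdot>\<^sub>m 1\<^sub>m n - hippo_A n) *\<^sub>v y = hippo_b n"
  shows "l2_norm y \<le> 1"
proof -
  define \<beta> where "\<beta> = 1 / l2_norm (hippo_B n)"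
  define t where "t = cmod (hippo_B n \<bullet> y)"
  have pos: "l2_norm (hippo_B n) > 0"
    using l2_norm_hippo_B_ge[OF n] by (rule less_le_trans[rotated]) simp
  have "(sqrt (1 / 2))\<^sup>2 \<le> (l2_norm (hippo_B n))\<^sup>2"
    using l2_norm_hippo_B_ge[OF n] by (intro power_mono) auto
  then have \<beta>: "\<beta> \<ge> 0" "\<beta>\<^sup>2 \<le> 2"
    using pos by (auto simp: \<beta>_def power_divide divide_simps)
  \<comment> \<open>The entries of \<open>hippo_B\<close> are real, so the Hermitian and bilinear
    products with \<open>y\<close> have equal modulus.\<close>
  have conj: "hippo_B n \<bullet>c y = cnj (hippo_B n \<bullet> y)"
    using y by (auto simp: scalar_prod_def hippo_B_def hippo_B_real_def intro!: sum.cong)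
  have "hippo_b n \<bullet>c y = of_real \<beta> * (hippo_B n \<bullet>c y)"
    unfolding hippo_b_def \<beta>_def using y hippo_carrier(2)[of n] by simp
  then have "cmod (hippo_b n \<bullet>c y) = \<beta> * t"
    using \<beta> by (simp add: conj norm_mult t_def)
  then have "(l2_norm y)\<^sup>2 / 2 + t\<^sup>2 \<le> \<beta> * t"
    using complex_Re_le_cmod[of "hippo_b n \<bullet>c y"] Re_hippo_resolvent_form[OF y s]
    by (simp add: eq t_def)
  moreover have "\<beta> * t \<le> t\<^sup>2 + \<beta>\<^sup>2 / 4"
    using zero_le_power2[of "t - \<beta> / 2"] by (simp add: power2_eq_square algebra_simps)
  ultimately have "(l2_norm y)\<^sup>2 \<le> 1\<^sup>2" using \<beta> by simp
  then show ?thesis by (rule power2_le_imp_le) simp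
qed

section \<open>Comparison of the transfer functions\<close>

text \<open>With common input, output row and feedthrough, only the states \<open>y\<close> and
  \<open>z\<close> differ. Their difference solves the perturbed equation with right-hand side
  \<open>E\<close> applied to \<open>y\<close>, so the lower bound applies to it directly.\<close>

lemma transfer_fun_perturbation:
  assumes n: "n \<ge> 1" and E: "E \<in> carrier_mat n n" and small: "spectral_norm E \<le> 1 / 4"
    and c: "c \<in> carrier_mat 1 n" and s: "Re s = 0"
  shows "cmod (transfer_fun (hippo_A n + E) (hippo_b n) c D s
           - transfer_fun (hippo_A n) (hippo_b n) c D s)
         \<le> 4 * spectral_norm c * spectral_norm E"
proof -
  let ?N = "s \<cdot>\<^sub>m 1\<^sub>m n - hippo_A n" and ?P = "s \<cdot>\<^sub>m 1\<^sub>m n - (hippo_A n + E)"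
  have N: "?N \<in> carrier_mat n n" and P: "?P \<in> carrier_mat n n"
    using E by (auto intro!: minus_carrier_mat)
  note Ninv = minv_inverse[OF N hippo_resolvent_det_nonzero[OF s]]
  have "det ?P \<noteq> 0"
    using small by (intro perturbed_resolvent_det_nonzero[OF E s]) simp
  note Pinv = minv_inverse[OF P this]
  define y where "y = minv ?N *\<^sub>v hippo_b n"
  define z where "z = minv ?P *\<^sub>v hippo_b n"
  have y: "y \<in> carrier_vec n" and z: "z \<in> carrier_vec n"
    using Ninv(3) Pinv(3) by (auto simp: y_def z_def)
  have Ny: "?N *\<^sub>v y = hippo_b n"
    unfolding y_def using assoc_mult_mat_vec[OF N Ninv(3), of "hippo_b n"] Ninv(1) by simp
  have Pz: "?P *\<^sub>v z = hippo_b n"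
    unfolding z_def using assoc_mult_mat_vec[OF P Pinv(3), of "hippo_b n"] Pinv(1) by simp
  have PN: "?P = ?N - E"
    using E hippo_carrier(1)[of n] by (intro eq_matI) auto
  have "?P *\<^sub>v (z - y) = ?P *\<^sub>v z - ?P *\<^sub>v y"
    by (rule mult_minus_distrib_mat_vec[OF P z y])
  also have "\<dots> = hippo_b n - (hippo_b n - E *\<^sub>v y)"
    unfolding Pz unfolding PN minus_mult_distrib_mat_vec[OF N E y] Ny ..
  also have "\<dots> = E *\<^sub>v y"
    using hippo_carrier(3)[of n] E y by (intro eq_vecI) auto
  finally have diff: "?P *\<^sub>v (z - y) = E *\<^sub>v y" .
  have "(1 / 2 - spectral_norm E) * l2_norm (z - y) \<le> l2_norm (E *\<^sub>v y)"
    using perturbed_resolvent_lower_bound[OF E _ s, of "z - y"] y z diff by simp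
  also have "\<dots> \<le> spectral_norm E * l2_norm y"
    by (rule l2_norm_mult_le[OF E y])
  also have "\<dots> \<le> spectral_norm E"
    using hippo_resolvent_input_bound[OF y s n Ny] spectral_norm_nonneg[of E]
    by (simp add: mult_left_le)
  finally have "(1 / 2 - spectral_norm E) * l2_norm (z - y) \<le> spectral_norm E" .
  \<comment> \<open>Since \<open>spectral_norm E\<close> is at most 1/4, a coercivity of at least
    1/4 remains; its reciprocal is the constant 4.\<close>
  moreover have "(1 / 4) * l2_norm (z - y) \<le> (1 / 2 - spectral_norm E) * l2_norm (z - y)"
    using small by (intro mult_right_mono) auto
  ultimately have zy: "l2_norm (z - y) \<le> 4 * spectral_norm E" by simp
  have "c *\<^sub>v z - c *\<^sub>v y = c *\<^sub>v (z - y)"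
    using mult_minus_distrib_mat_vec[OF c z y] by simp
  then have "(c *\<^sub>v z) $ 0 - (c *\<^sub>v y) $ 0 = (c *\<^sub>v (z - y)) $ 0"
    using c by (metis carrier_matD(1) dim_mult_mat_vec index_minus_vec(1) less_one)
  then have "cmod ((c *\<^sub>v z) $ 0 - (c *\<^sub>v y) $ 0) \<le> l2_norm (c *\<^sub>v (z - y))"
    using c norm_index_le_l2_norm[of 0 "c *\<^sub>v (z - y)"] by simp
  also have "\<dots> \<le> spectral_norm c * l2_norm (z - y)"
    using y z by (intro l2_norm_mult_le[OF c]) auto
  also have "\<dots> \<le> spectral_norm c * (4 * spectral_norm E)"
    by (intro mult_left_mono zy spectral_norm_nonneg)
  finally show ?thesis
    using E hippo_carrier(1)[of n] by (simp add: transfer_fun_def y_def z_def)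
qed

text \<open>In the original coordinates both systems have input \<open>hippo_b n\<close> and, by
  \<open>CC'\<close>, the same output row of norm 1.\<close>

lemma transfer_fun_DPLR_diff:
  assumes n: "n \<ge> 1" and E: "E \<in> carrier_mat n n" and small: "spectral_norm E \<le> 1 / 4"
    and V: "diagonalized_by (hippo_A_perp n) V \<Lambda>" and W: "diagonalized_by (hippo_A n + E) W \<Lambda>'"
    and C: "C \<in> carrier_mat 1 n" and C': "C' \<in> carrier_mat 1 n"
    and CC': "C' * minv W = C * minv V" and norm: "spectral_norm (C * minv V) = 1"
    and s: "Re s = 0"
  shows "cmod (transfer_fun (A_Pert n E W) (B_Pert n W) C' D s
           - transfer_fun (A_DPLR n V) (B_DPLR n V) C D s) \<le> 4 * spectral_norm E"
proof -
  have AE: "hippo_A n + E \<in> carrier_mat n n" using E by simp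
  have simV: "similar_mat_wit (hippo_A_perp n) \<Lambda> V (minv V)"
    and simW: "similar_mat_wit (hippo_A n + E) \<Lambda>' W (minv W)"
    using V W by (auto simp: diagonalized_by_def)
  \<comment> \<open>Facts 1 and 2 of each list are the two inverse identities for the eigenvector
    matrix and its \<open>minv\<close>; facts 6 and 7 are their dimensions.\<close>
  note V = similar_mat_witD2[OF hippo_A_perp_carrier simV]
  note W = similar_mat_witD2[OF AE simW]
  have "transfer_fun (A_DPLR n V) (B_DPLR n V) C D s =
      transfer_fun (hippo_A n) (hippo_b n) (C * minv V) D s"
    unfolding A_DPLR_def B_DPLR_def
    by (rule transfer_fun_similar[OF hippo_carrier(1) V(6,7,1,2) hippo_carrier(3) C
          hippo_resolvent_det_nonzero[OF s]])
  moreover have "transfer_fun (A_Pert n E W) (B_Pert n W) C' D s =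
      transfer_fun (hippo_A n + E) (hippo_b n) (C * minv V) D s"
    unfolding A_Pert_def B_Pert_def CC'[symmetric]
    using small by (intro transfer_fun_similar[OF AE W(6,7,1,2) hippo_carrier(3) C']
        perturbed_resolvent_det_nonzero[OF E s]) simp
  ultimately show ?thesis
    using transfer_fun_perturbation[OF n E small _ s, of "C * minv V" D] C V(7) norm by simp
qed

theorem theorem3:
  shows "\<exists>K::real. K \<ge> 0 \<and> (\<exists>\<epsilon>0::real. \<epsilon>0 > 0 \<and>
    (\<forall>(n::nat) (\<epsilon>::real) (E::complex mat)
       (V::complex mat) (\<Lambda>::complex mat) (W::complex mat) (\<Lambda>'::complex mat)
       (C_DPLR::complex mat) (C_Pert::complex mat) (D_DPLR::complex) (D_Pert::complex).
       n \<ge> 1 \<longrightarrow>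
       \<epsilon> \<le> \<epsilon>0 \<longrightarrow>
       E \<in> carrier_mat n n \<longrightarrow>
       unitary_mat V \<longrightarrow> diagonalized_by (hippo_A_perp n) V \<Lambda> \<longrightarrow>
       diagonalized_by (hippo_A n + E) W \<Lambda>' \<longrightarrow>
       C_DPLR \<in> carrier_mat 1 n \<longrightarrow> C_Pert \<in> carrier_mat 1 n \<longrightarrow>
       C_Pert * minv W = C_DPLR * minv V \<longrightarrow>
       D_Pert = D_DPLR \<longrightarrow>
       spectral_norm E \<le> \<epsilon> \<longrightarrow>
       l2_norm (W *\<^sub>v B_Pert n W) = 1 \<longrightarrow>
       l2_norm (V *\<^sub>v B_DPLR n V) = 1 \<longrightarrow>
       spectral_norm (C_Pert * minv W) = 1 \<longrightarrow>
       spectral_norm (C_DPLR * minv V) = 1 \<longrightarrow>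
       (\<forall>s::complex. Re s = 0 \<longrightarrow>
          cmod (transfer_fun (A_Pert n E W) (B_Pert n W) C_Pert D_Pert s
                - transfer_fun (A_DPLR n V) (B_DPLR n V) C_DPLR D_DPLR s)
            \<le> (2 * ln (real n) + 4) * \<epsilon> + K * (sqrt (ln (real n)) * \<epsilon>\<^sup>2))))"
\<comment> \<open>The error is already linear in \<epsilon>, so \<open>K = 0\<close> serves; the
  threshold 1/4 is half of the coercivity constant 1/2.\<close>
proof (rule exI[of _ 0], intro exI[of _ "1 / 4"] conjI allI impI)
  fix n :: nat and \<epsilon> :: real and E V \<Lambda> W \<Lambda>' C_DPLR C_Pert :: "complex mat"
    and D_DPLR D_Pert s :: complex
  assume n: "n \<ge> 1" and "\<epsilon> \<le> 1 / 4" and E: "E \<in> carrier_mat n n"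
    and V: "diagonalized_by (hippo_A_perp n) V \<Lambda>"
    and W: "diagonalized_by (hippo_A n + E) W \<Lambda>'"
    and C: "C_DPLR \<in> carrier_mat 1 n" "C_Pert \<in> carrier_mat 1 n"
      "C_Pert * minv W = C_DPLR * minv V" "spectral_norm (C_DPLR * minv V) = 1"
    and D: "D_Pert = D_DPLR" and \<epsilon>: "spectral_norm E \<le> \<epsilon>" and s: "Re s = 0"
  have "cmod (transfer_fun (A_Pert n E W) (B_Pert n W) C_Pert D_Pert s
          - transfer_fun (A_DPLR n V) (B_DPLR n V) C_DPLR D_DPLR s) \<le> 4 * spectral_norm E"
    unfolding D using \<epsilon> \<open>\<epsilon> \<le> 1 / 4\<close> by (intro transfer_fun_DPLR_diff[OF n E _ V W C s]) simp
  also have "\<dots> \<le> 4 * \<epsilon>" using \<epsilon> by simp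
  \<comment> \<open>Here \<open>ln (real n)\<close> is nonnegative because \<open>n\<close> is at
    least 1, and \<epsilon> is nonnegative because it dominates a norm.\<close>
  also have "\<dots> \<le> (2 * ln (real n) + 4) * \<epsilon>"
    using n \<epsilon> spectral_norm_nonneg[of E] by (intro mult_right_mono) auto
  finally show "cmod (transfer_fun (A_Pert n E W) (B_Pert n W) C_Pert D_Pert s
          - transfer_fun (A_DPLR n V) (B_DPLR n V) C_DPLR D_DPLR s)
      \<le> (2 * ln (real n) + 4) * \<epsilon> + 0 * (sqrt (ln (real n)) * \<epsilon>\<^sup>2)" by simp
qed auto

end
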